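(* Assume that the noise bound $\|y^\delta-y\|_{\mathcal Y}\le\delta$ and the conditional stability estimate (both as described in the context) hold, and that $x^\dagger\in\mathcal D(F)\cap\mathcal X_s$. Then for any approximate minimizer $x_\alpha^\delta\in\mathcal X(\alpha;y^\delta)$ with $\alpha=\delta^2$ one has $$\|x_\alpha^\delta-x^\dagger\|_{\mathcal X_r}\le C_3\,\delta^{\gamma\frac{s-r}{s+a}}\qquad\text{for all }-a\le r\le s,$$ with a constant $C_3$ depending only on the size of $\|x^\dagger\|_{\mathcal X_s}$.
   Context: $\mathcal X,\mathcal Y$ are Hilbert spaces and $F:\mathcal D(F)\subset\mathcal X\to\mathcal Y$ is a nonlinear operator; no properties of $F$ and $\mathcal D(F)$ are required apart from the conditional stability estimate below ($F$ may be non-differentiable or even discontinuous). $\{\mathcal X_t\}_{t\in\mathbb R}$ is the Hilbert scale generated by a densely defined injective self-adjoint linear operator $L:\mathcal D(L)\subset\mathcal X\to\mathcal X$ with compact inverse; the elements of $\mathcal X_t$ have finite norm $\|x\|_{\mathcal X_t}=\|L^tx\|_{\mathcal X}$. Exact data: $y=F(x^\dagger)$ with $x^\dagger\in\mathcal D(F)$ the true solution. Noise bound: the noisy data $y^\delta\in\mathcal Y$ satisfy $\|y^\delta-y\|_{\mathcal Y}\le\delta$. Conditional stability estimate: there exist a function $R:\mathbb R_+\to\mathbb R_+$ and real numbers $a\ge0$ and $s,\gamma$ with $-a\le s$ and $0<\gamma\le1$ such that $$\|x_1-x_2\|_{\mathcal X_{-a}}\le R(\rho)\,\|F(x_1)-F(x_2)\|_{\mathcal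 Y}^\gamma\qquad\text{for all }x_1,x_2\in\mathcal M_\rho^s,$$ where $\mathcal M_\rho^s=\{x\in\mathcal D(F)\cap\mathcal X_s:\ \|x\|_{\mathcal X_s}\le\rho\}$. Tikhonov functional: $T(x;\alpha,y^\delta)=\|F(x)-y^\delta\|_{\mathcal Y}^2+\alpha\|x\|_{\mathcal X_s}^2$. Set of approximate minimizers: $$\mathcal X(\alpha;y^\delta)=\{x\in\mathcal D(F):\ T(x;\alpha,y^\delta)\le\inf_{z\in\mathcal D(F)}T(z;\alpha,y^\delta)+\delta^2\}.$$ *)

theory Defs
  imports "HOL-Analysis.Analysis"
begin

text \<open>
  A (possibly unbounded) linear operator is given by its domain \<open>DL\<close> and a total function \<open>L\<close>
  of which only the values on \<open>DL\<close> matter. Hilbert spaces are real, i.e. types of class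
  \<open>{real_inner, complete_space}\<close>. A complex Hilbert space is covered through the inner product
  \<open>Re \<langle>x, y\<rangle>\<close>, which induces the same norm and the same notion of self-adjointness for
  complex-linear operators.
\<close>

definition linear_on_domain :: "'a::real_vector set \<Rightarrow> ('a \<Rightarrow> 'b::real_vector) \<Rightarrow> bool" where
  "linear_on_domain DL L \<longleftrightarrow> subspace DL \<and>
     (\<forall>x\<in>DL. \<forall>y\<in>DL. L (x + y) = L x + L y) \<and> (\<forall>c. \<forall>x\<in>DL. L (c *\<^sub>R x) = c *\<^sub>R L x)"

definition densely_defined :: "'a::topological_space set \<Rightarrow> bool" where
  "densely_defined DL \<longleftrightarrow> closure DL = UNIV"

text \<open>The right-hand side says that \<open>(y, z)\<close> lies in the graph of the Hilbert-space adjoint of \<open>L\<close>,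
  so this is the equality of \<open>L\<close> and its adjoint, domains included.\<close>

definition self_adjoint_on :: "'a::real_inner set \<Rightarrow> ('a \<Rightarrow> 'a) \<Rightarrow> bool" where
  "self_adjoint_on DL L \<longleftrightarrow>
     (\<forall>y z. (y \<in> DL \<and> z = L y) \<longleftrightarrow> (\<forall>x\<in>DL. inner (L x) y = inner x z))"

definition compact_operator :: "('a::real_normed_vector \<Rightarrow> 'b::real_normed_vector) \<Rightarrow> bool" where
  "compact_operator K \<longleftrightarrow> linear K \<and> compact (closure (K ` cball 0 1))"

definition has_compact_inverse :: "'a::real_normed_vector set \<Rightarrow> ('a \<Rightarrow> 'a) \<Rightarrow> bool" where
  "has_compact_inverse DL L \<longleftrightarrow>
     bij_betw L DL UNIV \<and> compact_operator (the_inv_into DL L)"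

definition hilbert_scale_generator :: "'a::{real_inner,complete_space} set \<Rightarrow> ('a \<Rightarrow> 'a) \<Rightarrow> bool" where
  "hilbert_scale_generator DL L \<longleftrightarrow>
     linear_on_domain DL L \<and> densely_defined DL \<and> inj_on L DL \<and>
     self_adjoint_on DL L \<and> has_compact_inverse DL L"

definition eigenspace :: "'a::real_vector set \<Rightarrow> ('a \<Rightarrow> 'a) \<Rightarrow> real \<Rightarrow> 'a set" where
  "eigenspace DL L l = {x\<in>DL. L x = l *\<^sub>R x}"

definition eigenvalues :: "'a::real_vector set \<Rightarrow> ('a \<Rightarrow> 'a) \<Rightarrow> real set" where
  "eigenvalues DL L = {l. \<exists>x\<in>eigenspace DL L l. x \<noteq> 0}"

definition orth_proj :: "'a::real_inner set \<Rightarrow> 'a \<Rightarrow> 'a" where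
  "orth_proj E x = (THE p. p \<in> E \<and> (\<forall>e\<in>E. inner (x - p) e = 0))"

text \<open>
  Since \<open>L\<close> has a compact inverse, its spectrum consists of its eigenvalues, and functional calculus
  gives \<open>L\<^sup>t x = (\<Sum>l. l\<^sup>t P\<^sub>l x)\<close>, where \<open>P\<^sub>l\<close> is the orthogonal projection onto the
  eigenspace of \<open>l\<close> and the domain of \<open>L\<^sup>t\<close> consists of the \<open>x\<close> for which the series converges.
  As \<open>L\<close> is not assumed positive, \<open>\<bar>l\<bar>\<close> replaces \<open>l\<close> in the power. This
  changes nothing if \<open>L\<close> is positive, and in general it changes neither the domain nor the norm,
  because \<open>l\<^sup>t\<close> has modulus \<open>\<bar>l\<bar> powr t\<close>.
\<close>

definition scale_term :: "'a::real_inner set \<Rightarrow> ('a \<Rightarrow> 'a) \<Rightarrow> real \<Rightarrow> 'a \<Rightarrow> real \<Rightarrow> 'a" where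
  "scale_term DL L t x l = (\<bar>l\<bar> powr t) *\<^sub>R orth_proj (eigenspace DL L l) x"

definition op_power :: "'a::real_inner set \<Rightarrow> ('a \<Rightarrow> 'a) \<Rightarrow> real \<Rightarrow> 'a \<Rightarrow> 'a" where
  "op_power DL L t x = (\<Sum>\<^sub>\<infinity>l\<in>eigenvalues DL L. scale_term DL L t x l)"

text \<open>For \<open>t < 0\<close> the space of index \<open>t\<close> is the completion of the whole space in the norm of
  index \<open>t\<close>. Only its elements lying in the original space are represented here; all arguments of the
  norms below are such elements.\<close>

definition scale_space :: "'a::real_inner set \<Rightarrow> ('a \<Rightarrow> 'a) \<Rightarrow> real \<Rightarrow> 'a set" where
  "scale_space DL L t = {x. scale_term DL L t x summable_on eigenvalues DL L}"

definition scale_norm :: "'a::real_inner set \<Rightarrow> ('a \<Rightarrow> 'a) \<Rightarrow> real \<Rightarrow> 'a \<Rightarrow> real" where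
  "scale_norm DL L t x = norm (op_power DL L t x)"

definition source_set ::
  "'a::real_inner set \<Rightarrow> ('a \<Rightarrow> 'a) \<Rightarrow> 'a set \<Rightarrow> real \<Rightarrow> real \<Rightarrow> 'a set" where
  "source_set DL L DF s \<rho> = {x \<in> DF \<inter> scale_space DL L s. scale_norm DL L s x \<le> \<rho>}"

definition conditional_stability ::
  "'a::real_inner set \<Rightarrow> ('a \<Rightarrow> 'a) \<Rightarrow> 'a set \<Rightarrow> ('a \<Rightarrow> 'b::real_normed_vector) \<Rightarrow>
     (real \<Rightarrow> real) \<Rightarrow> real \<Rightarrow> real \<Rightarrow> real \<Rightarrow> bool" where
  "conditional_stability DL L DF F R a s \<gamma> \<longleftrightarrow>
     (\<forall>\<rho>\<ge>0. R \<rho> \<ge> 0) \<and>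
     (\<forall>\<rho>\<ge>0. \<forall>x\<^sub>1\<in>source_set DL L DF s \<rho>. \<forall>x\<^sub>2\<in>source_set DL L DF s \<rho>.
        scale_norm DL L (- a) (x\<^sub>1 - x\<^sub>2) \<le> R \<rho> * norm (F x\<^sub>1 - F x\<^sub>2) powr \<gamma>)"

text \<open>The penalty is infinite outside the space of index \<open>s\<close>.\<close>

definition tikhonov ::
  "'a::real_inner set \<Rightarrow> ('a \<Rightarrow> 'a) \<Rightarrow> ('a \<Rightarrow> 'b::real_normed_vector) \<Rightarrow> real \<Rightarrow>
     real \<Rightarrow> 'b \<Rightarrow> 'a \<Rightarrow> ennreal" where
  "tikhonov DL L F s \<alpha> y x =
     (if x \<in> scale_space DL L s
      then ennreal ((norm (F x - y))\<^sup>2 + \<alpha> * (scale_norm DL L s x)\<^sup>2) else \<infinity>)"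

definition approx_minimizers ::
  "'a::real_inner set \<Rightarrow> ('a \<Rightarrow> 'a) \<Rightarrow> 'a set \<Rightarrow> ('a \<Rightarrow> 'b::real_normed_vector) \<Rightarrow> real \<Rightarrow>
     real \<Rightarrow> real \<Rightarrow> 'b \<Rightarrow> 'a set" where
  "approx_minimizers DL L DF F s \<delta> \<alpha> y =
     {x \<in> DF. tikhonov DL L F s \<alpha> y x \<le> (INF z\<in>DF. tikhonov DL L F s \<alpha> y z) + ennreal (\<delta>\<^sup>2)}"

end

theory Submission
  imports Defs
begin

text \<open>
  Comparing an approximate minimizer \<open>x\<close> with \<open>x_true\<close> in the Tikhonov functional gives, for
  \<open>\<alpha> = \<delta>\<^sup>2\<close>, both \<open>norm (F x - y_noisy) \<le> \<rho> * \<delta>\<close> and a bound \<open>\<rho>\<close> on the norm of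
  \<open>x\<close> of index \<open>s\<close>, where \<open>\<rho>\<^sup>2\<close> is \<open>2\<close> plus the squared norm of \<open>x_true\<close> of index \<open>s\<close>.
  Hence both elements lie in the source set of radius \<open>\<rho>\<close>, conditional stability bounds the error
  of index \<open>- a\<close> by a multiple of \<open>\<delta> powr \<gamma>\<close>, and interpolation between the indices
  \<open>- a\<close> and \<open>s\<close> gives the rate. The interpolation inequality is Hoelder's inequality for the
  sums of squares of the components in the eigenspaces, which are closed and mutually orthogonal.
\<close>

section \<open>Orthogonal projections\<close>

lemma parallelogram_law:
  fixes u v :: "'a::real_inner"
  shows "(norm (u + v))\<^sup>2 + (norm (u - v))\<^sup>2 = 2 * (norm u)\<^sup>2 + 2 * (norm v)\<^sup>2"
  by (simp add: power2_norm_eq_inner inner_diff_left inner_diff_right inner_add_left inner_add_right)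

text \<open>A minimizing sequence in \<open>E\<close> is Cauchy by the parallelogram law.
  Completeness provides its limit, which stays in \<open>E\<close> by closedness and attains the
  infimum by continuity of the norm.\<close>

lemma closed_subspace_nearest_point:
  fixes E :: "'a::{real_inner,complete_space} set"
  assumes "subspace E" "closed E"
  obtains p where "p \<in> E" "\<And>e. e \<in> E \<Longrightarrow> norm (x - p) \<le> norm (x - e)"
proof -
  define d where "d = (INF e\<in>E. (norm (x - e))\<^sup>2)"
  have ne: "E \<noteq> {}" using assms(1) subspace_0 by blast
  have bdd: "bdd_below ((\<lambda>e. (norm (x - e))\<^sup>2) ` E)"
    by (rule bdd_belowI[of _ 0]) auto
  have d_le: "d \<le> (norm (x - e))\<^sup>2" if "e \<in> E" for e
    unfolding d_def using bdd that by (rule cINF_lower)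
  have "\<exists>e\<in>E. (norm (x - e))\<^sup>2 < d + 1 / real (Suc n)" for n
    using cINF_less_iff[OF ne bdd, of "d + 1 / real (Suc n)"] by (simp add: d_def)
  then obtain e where e: "\<And>n. e n \<in> E" "\<And>n. (norm (x - e n))\<^sup>2 < d + 1 / real (Suc n)"
    by metis
  have dist_e: "(norm (e n - e m))\<^sup>2 \<le> 2 / real (Suc n) + 2 / real (Suc m)" for m n
  proof -
    \<comment> \<open>The midpoint of two near-minimizers lies in \<open>E\<close>, so its squared
      distance to \<open>x\<close> is at least \<open>d\<close>. In the parallelogram law this
      leaves little room for \<open>e n - e m\<close>.\<close>
    have "(1/2) *\<^sub>R (e n + e m) \<in> E"
      using assms(1) e(1) by (simp add: subspace_add subspace_scale)
    then have "d \<le> (norm (x - (1/2) *\<^sub>R (e n + e m)))\<^sup>2" by (rule d_le)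
    moreover have "(x - e n) + (x - e m) = 2 *\<^sub>R (x - (1/2) *\<^sub>R (e n + e m))"
      by (simp add: algebra_simps scaleR_2)
    then have "(norm ((x - e n) + (x - e m)))\<^sup>2 = 4 * (norm (x - (1/2) *\<^sub>R (e n + e m)))\<^sup>2"
      by (simp add: power_mult_distrib)
    moreover have "(norm ((x - e n) - (x - e m)))\<^sup>2 = (norm (e n - e m))\<^sup>2"
      by (simp add: norm_minus_commute)
    ultimately have "4 * d + (norm (e n - e m))\<^sup>2
        \<le> 2 * (norm (x - e n))\<^sup>2 + 2 * (norm (x - e m))\<^sup>2"
      using parallelogram_law[of "x - e n" "x - e m"] by linarith
    moreover have "2 / real (Suc k) = 2 * (1 / real (Suc k))" for k by simp
    ultimately show ?thesis using e(2)[of n] e(2)[of m] by smt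
  qed
  have "Cauchy e"
  proof (rule metric_CauchyI)
    fix \<epsilon> :: real assume "\<epsilon> > 0"
    then obtain N where N: "inverse (real (Suc N)) < \<epsilon>\<^sup>2 / 4"
      using reals_Archimedean[of "\<epsilon>\<^sup>2 / 4"] by auto
    have "dist (e n) (e m) < \<epsilon>" if "n \<ge> N" "m \<ge> N" for m n
    proof -
      have "2 / real (Suc n) \<le> 2 / real (Suc N)" "2 / real (Suc m) \<le> 2 / real (Suc N)"
        using that by (auto intro!: divide_left_mono)
      moreover have "4 * inverse (real (Suc N)) = 2 / real (Suc N) + 2 / real (Suc N)"
        by (simp add: divide_inverse)
      ultimately have "(norm (e n - e m))\<^sup>2 \<le> 4 * inverse (real (Suc N))"
        using dist_e[of n m] by linarith
      also have "\<dots> < \<epsilon>\<^sup>2" using N by simp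
      finally show ?thesis
        unfolding dist_norm by (rule power2_less_imp_less) (use \<open>\<epsilon> > 0\<close> in simp)
    qed
    then show "\<exists>M. \<forall>m\<ge>M. \<forall>n\<ge>M. dist (e m) (e n) < \<epsilon>" by blast
  qed
  then obtain p where p: "e \<longlonglongrightarrow> p" using Cauchy_convergent_iff convergent_def by blast
  have "p \<in> E" using closed_sequentially[OF assms(2)] e(1) p by blast
  have lim: "(\<lambda>n. (norm (x - e n))\<^sup>2) \<longlonglongrightarrow> (norm (x - p))\<^sup>2"
    by (intro tendsto_intros p)
  have "(\<lambda>n. d + 1 / real (Suc n)) \<longlonglongrightarrow> d + 0"
    by (intro tendsto_add tendsto_const LIMSEQ_Suc[OF lim_1_over_n])
  then have "(norm (x - p))\<^sup>2 \<le> d + 0"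
    using e(2) by (intro LIMSEQ_le[OF lim]) (auto intro: less_imp_le)
  then have le_d: "(norm (x - p))\<^sup>2 \<le> d" by simp
  have "norm (x - p) \<le> norm (x - u)" if "u \<in> E" for u
    using order_trans[OF le_d d_le[OF that]] by (rule power2_le_imp_le) simp
  with \<open>p \<in> E\<close> show ?thesis by (rule that)
qed

text \<open>The nearest point works: if \<open>x - p\<close> had a component along some
  \<open>e\<close> in \<open>E\<close>, shifting \<open>p\<close> along \<open>e\<close> would bring
  it closer to \<open>x\<close>.\<close>

lemma closed_subspace_orth_decomposition:
  fixes E :: "'a::{real_inner,complete_space} set"
  assumes "subspace E" "closed E"
  obtains p where "p \<in> E" "\<And>e. e \<in> E \<Longrightarrow> inner (x - p) e = 0"
proof -
  obtain p where p: "p \<in> E" "\<And>e. e \<in> E \<Longrightarrow> norm (x - p) \<le> norm (x - e)"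
    using closed_subspace_nearest_point[OF assms] by blast
  have "inner (x - p) e = 0" if "e \<in> E" for e
  proof (cases "e = 0")
    case False
    \<comment> \<open>This \<open>t\<close> minimizes the quadratic
      \<open>norm (x - p - t e)\<close> squared; the decrease achieved is
      \<open>inner (x - p) e\<close> squared over \<open>inner e e\<close>, which must therefore
      vanish.\<close>
    define t where "t = inner (x - p) e / inner e e"
    have "p + t *\<^sub>R e \<in> E" using assms(1) p(1) that by (simp add: subspace_add subspace_scale)
    then have "(norm (x - p))\<^sup>2 \<le> (norm ((x - p) - t *\<^sub>R e))\<^sup>2"
      using p(2) by (simp add: diff_diff_eq power_mono)
    also have "\<dots> = (norm (x - p))\<^sup>2 - 2 * t * inner (x - p) e + t * t * inner e e"
      unfolding power2_norm_eq_inner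
      by (simp add: inner_diff_left inner_diff_right inner_commute algebra_simps)
    also have "t * t * inner e e = t * inner (x - p) e"
      using False by (simp add: t_def)
    finally have "t * inner (x - p) e \<le> 0" by simp
    moreover have "inner e e > 0" using False by simp
    ultimately have "(inner (x - p) e)\<^sup>2 \<le> 0"
      by (simp add: t_def power2_eq_square divide_le_0_iff)
    then show ?thesis by simp
  qed simp
  with p(1) show ?thesis using that by blast
qed

text \<open>Two candidates differ by an element of \<open>E\<close> that is orthogonal to
  \<open>E\<close>, hence to itself. This uniqueness resolves the definite description in
  \<open>orth_proj\<close>.\<close>

lemma orth_proj_eqI:
  assumes "subspace E" "p \<in> E" "\<And>e. e \<in> E \<Longrightarrow> inner (x - p) e = 0"
  shows "orth_proj E x = p"
  unfolding orth_proj_def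
proof (rule the_equality)
  fix q assume q: "q \<in> E \<and> (\<forall>e\<in>E. inner (x - q) e = 0)"
  then have "p - q \<in> E" using assms(1,2) by (simp add: subspace_diff)
  then have "inner (x - q) (p - q) - inner (x - p) (p - q) = 0" using q assms(3) by simp
  then have "inner (p - q) (p - q) = 0" by (simp add: inner_diff_left)
  then show "q = p" by simp
qed (use assms in auto)

lemma orth_proj_closed_subspace:
  fixes E :: "'a::{real_inner,complete_space} set"
  assumes "subspace E" "closed E"
  shows orth_proj_mem: "orth_proj E x \<in> E"
    and orth_proj_orth: "e \<in> E \<Longrightarrow> inner (x - orth_proj E x) e = 0"
proof -
  obtain p where p: "p \<in> E" "\<And>e. e \<in> E \<Longrightarrow> inner (x - p) e = 0"
    using closed_subspace_orth_decomposition[OF assms] by blast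
  with assms(1) have "orth_proj E x = p" by (rule orth_proj_eqI)
  with p show "orth_proj E x \<in> E" "e \<in> E \<Longrightarrow> inner (x - orth_proj E x) e = 0" by auto
qed

lemma orth_proj_diff:
  fixes E :: "'a::{real_inner,complete_space} set"
  assumes "subspace E" "closed E"
  shows "orth_proj E (x - y) = orth_proj E x - orth_proj E y"
proof (rule orth_proj_eqI[OF assms(1)])
  show "orth_proj E x - orth_proj E y \<in> E"
    using assms by (simp add: subspace_diff orth_proj_mem)
  fix e assume "e \<in> E"
  have "(x - y) - (orth_proj E x - orth_proj E y) = (x - orth_proj E x) - (y - orth_proj E y)"
    by simp
  then show "inner (x - y - (orth_proj E x - orth_proj E y)) e = 0"
    using orth_proj_orth[OF assms \<open>e \<in> E\<close>] by (simp only: inner_diff_left[of "x - orth_proj E x"])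
qed

section \<open>Orthogonal series and Hoelder's inequality\<close>

text \<open>Pythagoras holds for every finite partial sum, and continuity of the squared norm
  carries it to the limit over finite subsets.\<close>

lemma has_sum_norm_Pythagorean:
  fixes f :: "'i \<Rightarrow> 'a::real_inner"
  assumes orth: "pairwise (\<lambda>i j. orthogonal (f i) (f j)) A" and sum: "(f has_sum S) A"
  shows "((\<lambda>i. (norm (f i))\<^sup>2) has_sum (norm S)\<^sup>2) A"
proof -
  have "((\<lambda>B. (norm (sum f B))\<^sup>2) \<longlongrightarrow> (norm S)\<^sup>2) (finite_subsets_at_top A)"
    using sum unfolding has_sum_def by (intro tendsto_intros)
  moreover have "\<forall>\<^sub>F B in finite_subsets_at_top A. (norm (sum f B))\<^sup>2 = (\<Sum>i\<in>B. (norm (f i))\<^sup>2)"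
    using orth by (intro eventually_finite_subsets_at_top_weakI norm_sum_Pythagorean)
      (auto intro: pairwise_subset)
  ultimately show ?thesis
    unfolding has_sum_def by (rule Lim_transform_eventually)
qed

text \<open>By Pythagoras, increments of the partial sums of \<open>f\<close> have squared norm
  equal to increments of a convergent real sum. The partial sums are thus Cauchy, and completeness
  applies.\<close>

lemma summable_on_orthogonal:
  fixes f :: "'i \<Rightarrow> 'a::{real_inner,complete_space}"
  assumes orth: "pairwise (\<lambda>i j. orthogonal (f i) (f j)) A"
    and sum: "(\<lambda>i. (norm (f i))\<^sup>2) summable_on A"
  shows "f summable_on A"
proof -
  define g where "g = (\<lambda>i. (norm (f i))\<^sup>2)"
  obtain S where S: "(g has_sum S) A" using sum by (auto simp: summable_on_def g_def)
  have "\<exists>P. eventually P (finite_subsets_at_top A) \<and>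
          (\<forall>F F'. P F \<and> P F' \<longrightarrow> dist (sum f F) (sum f F') < e)" if "e > 0" for e
  proof -
    \<comment> \<open>Two partial sums of \<open>g\<close> within \<open>d\<close> of
      \<open>S\<close> differ by less than \<open>2 * d\<close>, which has to be the square of
      \<open>e/2\<close>.\<close>
    define d where "d = (e/2)\<^sup>2 / 2"
    have two_d: "2 * d = (e/2)\<^sup>2" by (simp add: d_def)
    have "d > 0" using that by (simp add: d_def)
    with S have "\<forall>\<^sub>F B in finite_subsets_at_top A. dist (sum g B) S < d"
      unfolding has_sum_def by (simp add: tendsto_iff)
    then have "\<exists>B. finite B \<and> B \<subseteq> A \<and>
        (\<forall>F. finite F \<and> B \<subseteq> F \<and> F \<subseteq> A \<longrightarrow> dist (sum g F) S < d)"
      by (simp only: eventually_finite_subsets_at_top)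
    then obtain B where B: "finite B" "B \<subseteq> A"
      and near: "\<And>F. finite F \<Longrightarrow> B \<subseteq> F \<Longrightarrow> F \<subseteq> A \<Longrightarrow> dist (sum g F) S < d"
      by metis
    have close: "norm (sum f F - sum f B) < e/2" if F: "finite F" "B \<subseteq> F" "F \<subseteq> A" for F
    proof -
      have "(norm (sum f F - sum f B))\<^sup>2 = (norm (sum f (F - B)))\<^sup>2"
        using F by (simp add: sum_diff)
      also have "\<dots> = sum g (F - B)"
        unfolding g_def using F orth
        by (intro norm_sum_Pythagorean) (auto intro: pairwise_subset)
      also have "\<dots> = sum g F - sum g B" using F by (simp add: sum_diff)
      also have "\<dots> < (e/2)\<^sup>2"
        using near[OF F] near[OF B(1) order_refl B(2)] unfolding two_d[symmetric] dist_real_def by linarith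
      finally show ?thesis by (rule power2_less_imp_less) (use \<open>e > 0\<close> in simp)
    qed
    show ?thesis
    proof (intro exI[of _ "\<lambda>F. finite F \<and> B \<subseteq> F \<and> F \<subseteq> A"] conjI allI impI)
      show "\<forall>\<^sub>F F in finite_subsets_at_top A. finite F \<and> B \<subseteq> F \<and> F \<subseteq> A"
        unfolding eventually_finite_subsets_at_top using B by blast
      fix F F' assume "(finite F \<and> B \<subseteq> F \<and> F \<subseteq> A) \<and> finite F' \<and> B \<subseteq> F' \<and> F' \<subseteq> A"
      then have "norm (sum f F - sum f B) < e/2" "norm (sum f F' - sum f B) < e/2"
        using close by auto
      then show "dist (sum f F) (sum f F') < e"
        using dist_triangle_half_l[of "sum f F" "sum f B" e "sum f F'"] by (simp add: dist_norm)
    qed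
  qed
  then have "cauchy_filter (filtermap (sum f) (finite_subsets_at_top A))"
    by (simp add: cauchy_filter_metric_filtermap)
  then obtain L where "(sum f \<longlongrightarrow> L) (finite_subsets_at_top A)"
    using cauchy_filter_complete_converges[of "filtermap (sum f) (finite_subsets_at_top A)" UNIV]
      complete_UNIV
    unfolding filterlim_def by (auto simp: filtermap_bot_iff)
  then show ?thesis unfolding summable_on_def has_sum_def by blast
qed

text \<open>The conjugate exponents are 1/\<theta> and 1/(1 - \<theta>), written so that the
  endpoints 0 and 1 are included. After scaling both sums to 1, Young's inequality holds term by
  term and is then summed.\<close>

lemma infsum_Hoelder:
  fixes f g :: "'i \<Rightarrow> real"
  assumes f: "f summable_on A" "\<And>i. i \<in> A \<Longrightarrow> f i \<ge> 0"
    and g: "g summable_on A" "\<And>i. i \<in> A \<Longrightarrow> g i \<ge> 0"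
    and \<theta>: "0 \<le> \<theta>" "\<theta> \<le> 1"
  shows "(\<Sum>\<^sub>\<infinity>i\<in>A. f i powr \<theta> * g i powr (1 - \<theta>)) \<le> infsum f A powr \<theta> * infsum g A powr (1 - \<theta>)"
proof (cases "infsum f A = 0 \<or> infsum g A = 0")
  case True
  \<comment> \<open>One of the two families vanishes identically, and \<open>0 powr u = 0\<close>
    for every \<open>u\<close>, even for \<open>u = 0\<close>.\<close>
  then have "f i powr \<theta> * g i powr (1 - \<theta>) = 0" if "i \<in> A" for i
    using nonneg_infsum_le_0D[of f A i] nonneg_infsum_le_0D[of g A i] f g that by auto
  then have "(\<Sum>\<^sub>\<infinity>i\<in>A. f i powr \<theta> * g i powr (1 - \<theta>)) = 0" by (rule infsum_0)
  then show ?thesis by simp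
next
  case False
  define a b where "a = infsum f A" and "b = infsum g A"
  have "a > 0" "b > 0"
    using False infsum_nonneg[of A f] infsum_nonneg[of A g] f(2) g(2)
    by (auto simp: a_def b_def less_le)
  define c where "c = a powr \<theta> * b powr (1 - \<theta>)"
  have "c > 0" using \<open>a > 0\<close> \<open>b > 0\<close> by (simp add: c_def)
  have le: "f i powr \<theta> * g i powr (1 - \<theta>) \<le> c * (\<theta> / a * f i + (1 - \<theta>) / b * g i)"
    if "i \<in> A" for i
  proof (cases "f i = 0 \<or> g i = 0")
    case True
    with \<theta> f(2)[OF that] g(2)[OF that] \<open>a > 0\<close> \<open>b > 0\<close> \<open>c > 0\<close> show ?thesis by auto
  next
    case False
    then have pos: "f i > 0" "g i > 0" using f(2)[OF that] g(2)[OF that] by auto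
    then have "f i powr \<theta> * g i powr (1 - \<theta>)
        = c * ((f i / a) powr \<theta> * (g i / b) powr (1 - \<theta>))"
      using \<open>a > 0\<close> \<open>b > 0\<close> by (simp add: c_def powr_divide)
    also have "\<dots> \<le> c * (\<theta> * (f i / a) + (1 - \<theta>) * (g i / b))"
      using pos \<open>a > 0\<close> \<open>b > 0\<close> \<open>c > 0\<close> \<theta>
      by (intro mult_left_mono Youngs_inequality_0) auto
    finally show ?thesis by simp
  qed
  \<comment> \<open>Since \<open>a\<close> and \<open>b\<close> are the two sums, the majorant sums
    to \<open>c * (\<theta> + (1 - \<theta>))\<close>, that is, to \<open>c\<close>; it also yields
    summability of the products.\<close>
  have major: "((\<lambda>i. c * (\<theta> / a * f i + (1 - \<theta>) / b * g i))
      has_sum c * (\<theta> / a * a + (1 - \<theta>) / b * b)) A"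
    unfolding a_def b_def using f(1) g(1)
    by (intro has_sum_cmult_right has_sum_add has_sum_infsum)
  have "(\<lambda>i. f i powr \<theta> * g i powr (1 - \<theta>)) summable_on A"
    using has_sum_imp_summable[OF major] le by (rule summable_on_comparison_test) auto
  then have "(\<Sum>\<^sub>\<infinity>i\<in>A. f i powr \<theta> * g i powr (1 - \<theta>)) \<le> c * (\<theta> / a * a + (1 - \<theta>) / b * b)"
    using le major by (intro has_sum_mono[OF has_sum_infsum])
  also have "\<dots> = c" using \<open>a > 0\<close> \<open>b > 0\<close> by simp
  finally show ?thesis by (simp add: c_def a_def b_def)
qed

section \<open>The Hilbert scale\<close>

context
  fixes DL :: "'a::{real_inner,complete_space} set" and L :: "'a \<Rightarrow> 'a"
  assumes gen: "hilbert_scale_generator DL L"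
begin

section \<open>Eigenspaces and eigenvalues of the generator\<close>

lemma subspace_eigenspace: "subspace (eigenspace DL L l)"
proof -
  have lin: "linear_on_domain DL L" using gen by (simp add: hilbert_scale_generator_def)
  then have "0 \<in> DL" and "subspace DL" by (auto simp: linear_on_domain_def subspace_0)
  moreover have "L 0 = 0"
    using lin \<open>0 \<in> DL\<close> unfolding linear_on_domain_def by (metis scaleR_zero_left)
  ultimately show ?thesis
    using lin unfolding linear_on_domain_def eigenspace_def subspace_def
    by (auto simp: scaleR_add_right)
qed

lemma self_adjoint_iff:
  "y \<in> DL \<and> z = L y \<longleftrightarrow> (\<forall>x\<in>DL. inner (L x) y = inner x z)"
  using gen by (simp add: hilbert_scale_generator_def self_adjoint_on_def)

lemma closed_eigenspace: "closed (eigenspace DL L l)"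
proof -
  have "y \<in> eigenspace DL L l \<longleftrightarrow> (\<forall>x\<in>DL. inner (L x) y = inner x (l *\<^sub>R y))" for y
    unfolding self_adjoint_iff[symmetric] by (auto simp: eigenspace_def)
  then have "eigenspace DL L l = (\<Inter>x\<in>DL. {y. inner (L x) y = inner x (l *\<^sub>R y)})"
    by blast
  moreover have "closed {y. inner (L x) y = inner x (l *\<^sub>R y)}" for x
    by (intro closed_Collect_eq continuous_intros)
  ultimately show ?thesis by auto
qed

lemma eigenspaces_orthogonal:
  assumes "x \<in> eigenspace DL L l" "y \<in> eigenspace DL L m" "l \<noteq> m"
  shows "orthogonal x y"
proof -
  have "inner (L x) y = inner x (L y)"
    using self_adjoint_iff[of y "L y"] assms by (auto simp: eigenspace_def)
  then have "l * inner x y = m * inner x y" using assms by (simp add: eigenspace_def)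
  with \<open>l \<noteq> m\<close> show ?thesis by (simp add: orthogonal_def)
qed

text \<open>The compact inverse \<open>K\<close> is bounded and maps a unit eigenvector
  \<open>e\<close> to \<open>e\<close> divided by \<open>l\<close>, so
  \<open>1 / \<bar>l\<bar>\<close> is at most the bound of \<open>K\<close>. The gap around 0 makes
  the scale nested.\<close>

lemma eigenvalues_bounded_below:
  obtains c where "c > 0" "\<And>l. l \<in> eigenvalues DL L \<Longrightarrow> c \<le> \<bar>l\<bar>"
proof -
  define K where "K = the_inv_into DL L"
  have inj: "inj_on L DL" and lin: "linear_on_domain DL L" and K: "compact_operator K"
    using gen by (auto simp: hilbert_scale_generator_def has_compact_inverse_def K_def)
  have "bounded (K ` cball 0 1)"
    using K compact_imp_bounded bounded_subset closure_subset
    unfolding compact_operator_def by blast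
  then obtain B where B: "B > 0" "\<And>x. norm x \<le> 1 \<Longrightarrow> norm (K x) \<le> B"
    unfolding bounded_pos by auto
  have "inverse B \<le> \<bar>l\<bar>" if "l \<in> eigenvalues DL L" for l
  proof -
    obtain x where x: "x \<in> eigenspace DL L l" "x \<noteq> 0"
      using \<open>l \<in> eigenvalues DL L\<close> unfolding eigenvalues_def by blast
    define e where "e = (1 / norm x) *\<^sub>R x"
    have e: "e \<in> DL" "L e = l *\<^sub>R e" "norm e = 1"
      using subspace_scale[OF subspace_eigenspace x(1), of "1 / norm x"] x(2)
      by (auto simp: e_def eigenspace_def)
    have "l *\<^sub>R K e = K (l *\<^sub>R e)"
      using K by (simp add: compact_operator_def linear_scale)
    also have "\<dots> = e"
      using the_inv_into_f_f[OF inj e(1)] e(2) by (simp add: K_def)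
    finally have "\<bar>l\<bar> * norm (K e) = 1" using e(3) by (metis norm_scaleR)
    moreover have "\<bar>l\<bar> * norm (K e) \<le> \<bar>l\<bar> * B"
      using B(2) e(3) by (intro mult_left_mono) auto
    ultimately show ?thesis using B(1) by (simp add: field_simps)
  qed
  then show ?thesis using that[of "inverse B"] B(1) by auto
qed

section \<open>Membership and norms of the scale through weighted sums of squared
  eigencomponents\<close>

definition spectral_weight :: "real \<Rightarrow> 'a \<Rightarrow> real \<Rightarrow> real" where
  "spectral_weight t x l = \<bar>l\<bar> powr (2 * t) * (norm (orth_proj (eigenspace DL L l) x))\<^sup>2"

lemma spectral_weight_nonneg: "spectral_weight t x l \<ge> 0"
  by (simp add: spectral_weight_def)

lemma norm_scale_term: "(norm (scale_term DL L t x l))\<^sup>2 = spectral_weight t x l"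
proof -
  have "(\<bar>l\<bar> powr t)\<^sup>2 = \<bar>l\<bar> powr (2 * t)"
    by (simp add: power2_eq_square flip: powr_add)
  then show ?thesis by (simp add: scale_term_def spectral_weight_def power_mult_distrib)
qed

lemma scale_terms_orthogonal:
  "pairwise (\<lambda>l m. orthogonal (scale_term DL L t x l) (scale_term DL L t x m)) A"
  unfolding pairwise_def scale_term_def
  by (meson eigenspaces_orthogonal orth_proj_mem subspace_eigenspace closed_eigenspace
      subspace_scale)

text \<open>For mutually orthogonal terms, the vector series and the series of squared norms
  converge together, so membership becomes a question about nonnegative real series.\<close>

lemma scale_space_iff:
  "x \<in> scale_space DL L t \<longleftrightarrow> spectral_weight t x summable_on eigenvalues DL L"
  using has_sum_norm_Pythagorean[OF scale_terms_orthogonal]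
    summable_on_orthogonal[OF scale_terms_orthogonal]
  unfolding scale_space_def norm_scale_term mem_Collect_eq summable_on_def by blast

lemma scale_norm_power2:
  assumes "x \<in> scale_space DL L t"
  shows "(scale_norm DL L t x)\<^sup>2 = infsum (spectral_weight t x) (eigenvalues DL L)"
  using has_sum_norm_Pythagorean[OF scale_terms_orthogonal has_sum_infsum] assms
  unfolding scale_space_def norm_scale_term scale_norm_def op_power_def
  by (auto simp: has_sum_iff)

lemma scale_term_diff:
  "scale_term DL L t (x - y) l = scale_term DL L t x l - scale_term DL L t y l"
  by (simp add: scale_term_def orth_proj_diff subspace_eigenspace closed_eigenspace
      scaleR_diff_right)

lemma scale_norm_diff:
  assumes "x \<in> scale_space DL L t" "y \<in> scale_space DL L t"
  shows "x - y \<in> scale_space DL L t"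
    and "scale_norm DL L t (x - y) \<le> scale_norm DL L t x + scale_norm DL L t y"
proof -
  have "((\<lambda>l. scale_term DL L t x l + - scale_term DL L t y l)
      has_sum (op_power DL L t x + - op_power DL L t y)) (eigenvalues DL L)"
    using assms unfolding scale_space_def op_power_def
    by (intro has_sum_add) (auto simp: has_sum_uminus)
  then have *: "(scale_term DL L t (x - y)
      has_sum (op_power DL L t x - op_power DL L t y)) (eigenvalues DL L)"
    by (simp add: scale_term_diff[abs_def])
  then show "x - y \<in> scale_space DL L t"
    by (auto simp: scale_space_def summable_on_def)
  from * have "op_power DL L t (x - y) = op_power DL L t x - op_power DL L t y"
    by (simp add: op_power_def infsumI)
  then show "scale_norm DL L t (x - y) \<le> scale_norm DL L t x + scale_norm DL L t y"
    by (simp add: scale_norm_def norm_triangle_ineq4)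
qed

text \<open>Passing from index \<open>s\<close> to \<open>t\<close> multiplies each weight by
  \<open>\<bar>l\<bar> powr (2 * (t - s))\<close>. The exponent is not positive and
  \<open>\<bar>l\<bar>\<close> stays above \<open>c\<close>, so this factor is bounded.\<close>

lemma scale_space_mono:
  assumes "x \<in> scale_space DL L s" "t \<le> s"
  shows "x \<in> scale_space DL L t"
proof -
  obtain c where c: "c > 0" "\<And>l. l \<in> eigenvalues DL L \<Longrightarrow> c \<le> \<bar>l\<bar>"
    using eigenvalues_bounded_below by blast
  have le: "spectral_weight t x l \<le> c powr (2 * (t - s)) * spectral_weight s x l"
    if "l \<in> eigenvalues DL L" for l
  proof -
    have "\<bar>l\<bar> powr (2 * t) = \<bar>l\<bar> powr (2 * (t - s)) * \<bar>l\<bar> powr (2 * s)"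
      by (simp flip: powr_add)
    also have "\<dots> \<le> c powr (2 * (t - s)) * \<bar>l\<bar> powr (2 * s)"
      using c(1) c(2)[OF that] \<open>t \<le> s\<close> by (intro mult_right_mono powr_mono2') auto
    finally show ?thesis
      unfolding spectral_weight_def mult.assoc[symmetric] by (rule mult_right_mono) simp
  qed
  have "(\<lambda>l. c powr (2 * (t - s)) * spectral_weight s x l) summable_on eigenvalues DL L"
    using assms(1) by (intro summable_on_cmult_right) (simp add: scale_space_iff)
  then show ?thesis
    unfolding scale_space_iff
    using le spectral_weight_nonneg by (rule summable_on_comparison_test)
qed

text \<open>Each weight of index \<open>r\<close> is the product of the powers \<theta> and 1 -
  \<theta> of the weights of index \<open>p\<close> and \<open>q\<close>, so the inequality for the
  squared norms is Hoelder's.\<close>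

lemma scale_norm_interpolation:
  assumes "x \<in> scale_space DL L p" "x \<in> scale_space DL L q"
    and "0 \<le> \<theta>" "\<theta> \<le> 1" and r: "r = \<theta> * p + (1 - \<theta>) * q" "x \<in> scale_space DL L r"
  shows "scale_norm DL L r x \<le> scale_norm DL L p x powr \<theta> * scale_norm DL L q x powr (1 - \<theta>)"
proof -
  have split: "spectral_weight r x l
      = spectral_weight p x l powr \<theta> * spectral_weight q x l powr (1 - \<theta>)" for l
  proof -
    define w where "w = (norm (orth_proj (eigenspace DL L l) x))\<^sup>2"
    have "w \<ge> 0" by (simp add: w_def)
    have w: "w powr \<theta> * w powr (1 - \<theta>) = w"
      using \<open>w \<ge> 0\<close> by (simp flip: powr_add)
    have "\<bar>l\<bar> powr (2 * r) = \<bar>l\<bar> powr (2 * p * \<theta>) * \<bar>l\<bar> powr (2 * q * (1 - \<theta>))"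
      by (simp add: r(1) algebra_simps flip: powr_add)
    then have "\<bar>l\<bar> powr (2 * r) * w = (\<bar>l\<bar> powr (2 * p * \<theta>) * \<bar>l\<bar> powr (2 * q * (1 - \<theta>))) *
        (w powr \<theta> * w powr (1 - \<theta>))" by (simp add: w)
    also have "\<dots> = (\<bar>l\<bar> powr (2 * p) * w) powr \<theta> * (\<bar>l\<bar> powr (2 * q) * w) powr (1 - \<theta>)"
      using \<open>w \<ge> 0\<close> by (simp add: powr_mult powr_powr)
    finally show ?thesis by (simp add: spectral_weight_def w_def)
  qed
  have pow: "(u\<^sup>2) powr \<eta> = (u powr \<eta>)\<^sup>2" if "u \<ge> 0" for u \<eta> :: real
    using that by (simp add: power2_eq_square powr_mult)
  have "(scale_norm DL L r x)\<^sup>2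
      \<le> ((scale_norm DL L p x)\<^sup>2) powr \<theta> * ((scale_norm DL L q x)\<^sup>2) powr (1 - \<theta>)"
    unfolding scale_norm_power2[OF assms(1)] scale_norm_power2[OF assms(2)]
      scale_norm_power2[OF r(2)] ext[OF split]
    using assms(1-4) by (intro infsum_Hoelder) (simp_all add: scale_space_iff spectral_weight_nonneg)
  also have "\<dots> = (scale_norm DL L p x powr \<theta> * scale_norm DL L q x powr (1 - \<theta>))\<^sup>2"
    by (simp add: pow scale_norm_def power_mult_distrib)
  finally show ?thesis by (rule power2_le_imp_le) simp
qed

end

section \<open>Tikhonov regularization\<close>

lemma approx_minimizer_bounds:
  fixes F :: "'a::real_inner \<Rightarrow> 'b::real_normed_vector"
  assumes x: "x \<in> approx_minimizers DL L DF F s \<delta> (\<delta>\<^sup>2) y_noisy" and "\<delta> > 0"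
    and x_true: "x_true \<in> DF" "x_true \<in> scale_space DL L s"
    and noise: "norm (y_noisy - F x_true) \<le> \<delta>"
    and \<rho>: "\<rho> = sqrt (2 + (scale_norm DL L s x_true)\<^sup>2)"
  shows "x \<in> source_set DL L DF s \<rho>" and "norm (F x - y_noisy) \<le> \<rho> * \<delta>"
proof -
  define E where "E = scale_norm DL L s x_true"
  have \<rho>2: "\<rho>\<^sup>2 = 2 + E\<^sup>2" and "\<rho> \<ge> 0" by (simp_all add: \<rho> E_def)
  have "x \<in> DF" using x by (simp add: approx_minimizers_def)
  have "tikhonov DL L F s (\<delta>\<^sup>2) y_noisy x
      \<le> (INF z\<in>DF. tikhonov DL L F s (\<delta>\<^sup>2) y_noisy z) + ennreal (\<delta>\<^sup>2)"
    using x by (simp add: approx_minimizers_def)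
  also have "\<dots> \<le> tikhonov DL L F s (\<delta>\<^sup>2) y_noisy x_true + ennreal (\<delta>\<^sup>2)"
    using x_true(1) by (intro add_right_mono INF_lower)
  also have "\<dots> = ennreal ((norm (F x_true - y_noisy))\<^sup>2 + \<delta>\<^sup>2 * E\<^sup>2 + \<delta>\<^sup>2)"
    using x_true(2) by (simp add: tikhonov_def E_def ennreal_plus)
  \<comment> \<open>The residual of \<open>x_true\<close> and the slack allowed to approximate
    minimizers contribute \<delta> squared each, which explains the 2 in \<rho>.\<close>
  also have "\<dots> \<le> ennreal (\<delta>\<^sup>2 * \<rho>\<^sup>2)"
    using noise power_mono[of "norm (F x_true - y_noisy)" \<delta> 2]
    by (intro ennreal_leI) (simp add: \<rho>2 norm_minus_commute algebra_simps)
  finally have T: "tikhonov DL L F s (\<delta>\<^sup>2) y_noisy x \<le> ennreal (\<delta>\<^sup>2 * \<rho>\<^sup>2)" .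
  \<comment> \<open>The functional is infinite outside the space of index \<open>s\<close>, so the
    finite bound forces membership.\<close>
  then have x_s: "x \<in> scale_space DL L s"
    by (auto simp: tikhonov_def top_unique split: if_splits)
  with T have sum_le: "(norm (F x - y_noisy))\<^sup>2 + \<delta>\<^sup>2 * (scale_norm DL L s x)\<^sup>2 \<le> \<delta>\<^sup>2 * \<rho>\<^sup>2"
    by (simp add: tikhonov_def ennreal_le_iff del: ennreal_plus)
  have "\<delta>\<^sup>2 * (scale_norm DL L s x)\<^sup>2 \<le> \<delta>\<^sup>2 * \<rho>\<^sup>2"
    using sum_le zero_le_power2[of "norm (F x - y_noisy)"] by linarith
  then have "(scale_norm DL L s x)\<^sup>2 \<le> \<rho>\<^sup>2" using \<open>\<delta> > 0\<close> by simp
  then have "scale_norm DL L s x \<le> \<rho>" by (rule power2_le_imp_le) fact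
  with x_s \<open>x \<in> DF\<close> show "x \<in> source_set DL L DF s \<rho>" by (simp add: source_set_def)
  have "(norm (F x - y_noisy))\<^sup>2 \<le> (\<rho> * \<delta>)\<^sup>2"
    using sum_le zero_le_power2[of "\<delta> * scale_norm DL L s x"]
    unfolding power_mult_distrib mult.commute[of "\<rho>\<^sup>2"] by linarith
  then show "norm (F x - y_noisy) \<le> \<rho> * \<delta>"
    by (rule power2_le_imp_le) (use \<open>\<delta> > 0\<close> \<open>\<rho> \<ge> 0\<close> in simp)
qed

text \<open>The bound does not involve \<theta>, which allows one constant for all indices
  \<open>r\<close> in the theorem.\<close>

lemma powr_le_one_plus:
  fixes u \<theta> :: real
  assumes "u \<ge> 0" "0 \<le> \<theta>" "\<theta> \<le> 1"
  shows "u powr \<theta> \<le> 1 + u"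
proof -
  have "u powr \<theta> \<le> (1 + u) powr \<theta>" using assms by (intro powr_mono2) auto
  also have "\<dots> \<le> (1 + u) powr 1" using assms by (intro powr_mono) auto
  finally show ?thesis using assms by simp
qed

text \<open>Membership of the difference belongs to the conclusion because \<open>infsum\<close> is
  0 for a non-summable family, so \<open>scale_norm\<close> would be 0 outside the space.
  \<open>C\<^sub>3\<close> is chosen before \<open>x_true\<close>, the data, \<delta> and
  \<open>r\<close>; beyond the fixed problem it sees only the norm of \<open>x_true\<close>.\<close>

theorem theorem1p2:
  fixes DL :: "'a::{real_inner,complete_space} set" and L :: "'a \<Rightarrow> 'a"
    and DF :: "'a set" and F :: "'a \<Rightarrow> 'b::{real_inner,complete_space}"
    and R :: "real \<Rightarrow> real" and a s \<gamma> :: real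
  assumes "hilbert_scale_generator DL L"
    and "a \<ge> 0" and "- a \<le> s" and "0 < \<gamma>" and "\<gamma> \<le> 1"
    and "conditional_stability DL L DF F R a s \<gamma>"
  shows "\<exists>C\<^sub>3 :: real \<Rightarrow> real.
    \<forall>x_true \<in> DF \<inter> scale_space DL L s. \<forall>y y_noisy. \<forall>\<delta>>0. \<forall>\<alpha>.
      y = F x_true \<and> norm (y_noisy - y) \<le> \<delta> \<and> \<alpha> = \<delta>\<^sup>2 \<longrightarrow>
      (\<forall>x \<in> approx_minimizers DL L DF F s \<delta> \<alpha> y_noisy. \<forall>r. - a \<le> r \<and> r \<le> s \<longrightarrow>
         x - x_true \<in> scale_space DL L r \<and>
         scale_norm DL L r (x - x_true)
           \<le> C\<^sub>3 (scale_norm DL L s x_true) * \<delta> powr (\<gamma> * ((s - r) / (s + a))))"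
proof -
  note gen = assms(1)
  \<comment> \<open>\<open>K\<close> is the constant in the error bound of index \<open>- a\<close>,
    and twice the radius bounds the error of index \<open>s\<close>. \<open>C\<close> dominates the
    product of their powers \<theta> and 1 - \<theta>.\<close>
  define radius where "radius E = sqrt (2 + E\<^sup>2)" for E :: real
  define K where "K E = R (radius E) * (1 + radius E) powr \<gamma>" for E
  define C where "C E = (1 + K E) * (1 + 2 * radius E)" for E
  have "x - x_true \<in> scale_space DL L r \<and>
      scale_norm DL L r (x - x_true)
        \<le> C (scale_norm DL L s x_true) * \<delta> powr (\<gamma> * ((s - r) / (s + a)))"
    if x_true: "x_true \<in> DF" "x_true \<in> scale_space DL L s" and "\<delta> > 0"
      and noise: "norm (y_noisy - F x_true) \<le> \<delta>"
      and x: "x \<in> approx_minimizers DL L DF F s \<delta> (\<delta>\<^sup>2) y_noisy" and r: "- a \<le> r" "r \<le> s"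
    for x_true y_noisy \<delta> x r
  proof -
    define E where "E = scale_norm DL L s x_true"
    define \<rho> where "\<rho> = radius E"
    define k where "k = K E"
    define N where "N t = scale_norm DL L t (x - x_true)" for t
    \<comment> \<open>If \<open>s = - a\<close>, then \<open>r = s\<close> and division by zero
      gives \<theta> = 0, which is still a valid interpolation parameter.\<close>
    define \<theta> where "\<theta> = (s - r) / (s + a)"
    have N_nonneg: "N t \<ge> 0" for t by (simp add: N_def scale_norm_def)
    have "E \<le> \<rho>" "\<rho> \<ge> 0" by (simp_all add: \<rho>_def radius_def real_le_rsqrt)
    have "R \<rho> \<ge> 0" using assms(6) \<open>\<rho> \<ge> 0\<close> by (simp add: conditional_stability_def)
    then have "k \<ge> 0" by (simp add: k_def K_def \<rho>_def)
    have \<theta>: "0 \<le> \<theta>" "\<theta> \<le> 1" "r = \<theta> * (- a) + (1 - \<theta>) * s"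
    proof -
      show "0 \<le> \<theta>" "\<theta> \<le> 1" using r by (auto simp: \<theta>_def divide_le_eq)
      have "\<theta> * (s + a) = s - r" using r by (auto simp: \<theta>_def)
      then show "r = \<theta> * (- a) + (1 - \<theta>) * s" by (simp add: algebra_simps)
    qed
    have x_src: "x \<in> source_set DL L DF s \<rho>" and res: "norm (F x - y_noisy) \<le> \<rho> * \<delta>"
      using approx_minimizer_bounds[OF x \<open>\<delta> > 0\<close> x_true noise]
      by (simp_all add: \<rho>_def radius_def E_def)
    have x_true_src: "x_true \<in> source_set DL L DF s \<rho>"
      using x_true \<open>E \<le> \<rho>\<close> by (simp add: source_set_def E_def)
    have diff_s: "x - x_true \<in> scale_space DL L s" and "N s \<le> \<rho> + E"
      using scale_norm_diff[OF gen _ x_true(2), of x] x_src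
      by (auto simp: source_set_def N_def E_def)
    then have N_s: "N s \<le> 2 * \<rho>" using \<open>E \<le> \<rho>\<close> by simp
    have mem: "x - x_true \<in> scale_space DL L t" if "t \<le> s" for t
      using scale_space_mono[OF gen diff_s that] .
    \<comment> \<open>The residual of \<open>x\<close> accounts for \<rho> and the noise for
      1.\<close>
    have "norm (F x - F x_true) \<le> (1 + \<rho>) * \<delta>"
      using norm_triangle_ineq[of "F x - y_noisy" "y_noisy - F x_true"] res noise
      by (simp add: algebra_simps)
    then have "norm (F x - F x_true) powr \<gamma> \<le> ((1 + \<rho>) * \<delta>) powr \<gamma>"
      using assms(4) by (intro powr_mono2) auto
    then have "R \<rho> * norm (F x - F x_true) powr \<gamma> \<le> k * \<delta> powr \<gamma>"
      using \<open>R \<rho> \<ge> 0\<close> \<open>\<rho> \<ge> 0\<close> \<open>\<delta> > 0\<close>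
      by (simp add: k_def K_def powr_mult mult_left_mono mult.assoc flip: \<rho>_def)
    moreover have "N (- a) \<le> R \<rho> * norm (F x - F x_true) powr \<gamma>"
      using assms(6) \<open>\<rho> \<ge> 0\<close> x_src x_true_src by (simp add: conditional_stability_def N_def)
    ultimately have N_a: "N (- a) \<le> k * \<delta> powr \<gamma>" by linarith
    \<comment> \<open>Only the factor of index \<open>- a\<close> carries a power of \<delta>, so
      the rate is \<gamma> times the weight \<theta> of that index.\<close>
    have "N r \<le> N (- a) powr \<theta> * N s powr (1 - \<theta>)"
      using scale_norm_interpolation[OF gen mem mem \<theta> mem] assms(3) r(2) by (simp add: N_def)
    also have "\<dots> \<le> (k * \<delta> powr \<gamma>) powr \<theta> * (2 * \<rho>) powr (1 - \<theta>)"
      using N_a N_s N_nonneg \<theta>(1,2) by (intro mult_mono powr_mono2) auto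
    also have "\<dots> = k powr \<theta> * (2 * \<rho>) powr (1 - \<theta>) * \<delta> powr (\<gamma> * \<theta>)"
      using \<open>k \<ge> 0\<close> by (simp add: powr_mult powr_powr)
    also have "\<dots> \<le> (1 + k) * (1 + 2 * \<rho>) * \<delta> powr (\<gamma> * \<theta>)"
      using \<open>k \<ge> 0\<close> \<open>\<rho> \<ge> 0\<close> \<theta>(1,2)
      by (intro mult_right_mono mult_mono powr_le_one_plus) auto
    finally show ?thesis
      using mem[OF r(2)] by (simp add: N_def C_def k_def \<rho>_def E_def \<theta>_def)
  qed
  then show ?thesis by (intro exI[of _ C]) auto
qed

end
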